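(* Suppose that $\mathbb P^{X} = \mathbb P^{g^{*}(Z)}$ for some $g^{*} \in \mathcal G(d_Z,d_g,\beta,K)$. Suppose that, for some $\gamma\ge1$ and with $a_n=n^{-\frac{2\gamma}{2\gamma+d}}$, the critic network class satisfies $F\ge1$, $L_f\ge\log_2(n)\log_2(4d\vee4\gamma)$, $\min_{i=1,\dots,L_f}p_{f,i}\gtrsim na_n$ and $s_f\gtrsim\log(n)\,na_n$ (with constants depending on $\gamma,d$). Let $(\hat g_n)_{n\in\mathbb N}$ be a sequence of random measurable functions $\hat g_n:\mathbb R^{d_Z}\to\mathbb R^d$, independent of $Z$, with $\mathbb E W_{1,n}(\hat g_n) \to 0$. Then $\hat g_n(Z)$ converges in distribution to $g^{*}(Z)$, i.e. to $X$: $$\hat g_n(Z) \overset{d}{\to} g^{*}(Z) \overset{d}{=} X .$$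
   Context: Notation: $a\gtrsim b$ means $a\ge cb$ for a suitable constant $c>0$ (here depending only on $\gamma,d$). $X$ is a random variable with values in $[0,1]^d$, $Z$ a random variable with values in $[0,1]^{d_Z}$. Hölder classes: for $T\subset\mathbb R^r$, $\beta\ge1$, $K>0$, $C^\beta(T,K)$ is the set of $f:T\to\mathbb R$ with $\sum_{0\le|\alpha|<\beta}\|\partial^\alpha f\|_\infty+\sum_{|\alpha|=\beta-1}\sup_{x\ne y}\frac{|\partial^\alpha f(x)-\partial^\alpha f(y)|}{|x-y|_\infty}\le K$. $\mathcal G(d_Z,d_g,\beta,K)$ is the set of measurable $g:\mathbb R^{d_Z}\to\mathbb R^d$ such that each component depends only on $d_g$ of its arguments and lies in $C^\beta([0,1]^{d_Z},K)$. Networks: $\sigma(x)=\max\{x,0\}$, $\sigma_v(x)=\sigma(x-v)$ componentwise. For $L\in\mathbb N$, $\mathbf p=(p_0,\dots,p_{L+1})\in\mathbb N^{L+2}$, $s>0$, $F>0$, $\mathcal R(L,\mathbf p,s)=\mathcal R(L,\mathbf p,s,F)$ is the set of $h:\mathbb R^{p_0}\to\mathbb R^{p_{L+1}}$ of the form $h(x)=W^{(L)}\sigma_{v^{(L)}}W^{(L-1)}\cdots W^{(1)}\sigma_{v^{(1)}}W^{(0)}x$ with $W^{(l)}\in\mathbb R^{p_{l+1}\times p_l}$, $v^{(l)}\in\mathbb R^{p_l}$, all entries bounded by 1 in absolute value, at most $s$ nonzero entries in total, and $\sup_{x\in[0,1]^{p_0}}|h(x)|_\infty\le F$. The critic class is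 $\mathcal R(L_f,\mathbf p_f,s_f)$ with $p_{f,0}=d$, $p_{f,L_f+1}=1$; its parameters may depend on $n$. $W_{1,n}(g)=\sup_{f\in\mathcal R(L_f,\mathbf p_f,s_f),\|f\|_L\le1}\{\mathbb Ef(X)-\mathbb Ef(g(Z))\}$ for deterministic measurable $g$, with $\|f\|_L$ the Lipschitz constant with respect to the Euclidean norm; $W_{1,n}(\hat g_n)$ is this functional evaluated at the random function $\hat g_n$.
   Formalization: The formal theorem additionally assumes s_f − L_f → ∞; without an upper bound on depth relative to sparsity the claim fails, since if s_f < L_f + 1 every critic is constant and W_{1,n} ≡ 0. *)

theory Defs
  imports "HOL-Probability.Probability"
begin

section \<open>Hoelder classes\<close>

definition mi_order :: "('r::finite \<Rightarrow> nat) \<Rightarrow> nat" where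
  "mi_order \<alpha> = (\<Sum>i\<in>UNIV. \<alpha> i)"

text \<open>
  \<open>D \<alpha>\<close> is the iterated partial derivative of \<open>f\<close> with multi-index \<open>\<alpha>\<close>. Derivatives are taken
  within \<open>T\<close>, hence one-sidedly at the boundary; on the unit cube, the only set used below, this
  determines \<open>D \<alpha>\<close> uniquely on \<open>T\<close> for all \<open>mi_order \<alpha> < \<beta>\<close>.
\<close>

definition partials_within ::
  "(real^'r) set \<Rightarrow> real \<Rightarrow> (real^'r \<Rightarrow> real) \<Rightarrow> (('r::finite \<Rightarrow> nat) \<Rightarrow> real^'r \<Rightarrow> real) \<Rightarrow> bool" where
  "partials_within T \<beta> f D \<longleftrightarrow>
     (\<forall>x\<in>T. D (\<lambda>_. 0) x = f x) \<and>
     (\<forall>\<alpha> i. real (mi_order \<alpha>) + 1 < \<beta> \<longrightarrow>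
        (\<forall>x\<in>T. ((\<lambda>t. D \<alpha> (x + t *\<^sub>R axis i 1)) has_real_derivative D (\<alpha>(i := Suc (\<alpha> i))) x)
                  (at 0 within {t. x + t *\<^sub>R axis i 1 \<in> T})))"

text \<open>The norm is computed in \<^typ>\<open>ennreal\<close>, so that the bound by \<open>K\<close> includes its finiteness.\<close>

definition holder_class :: "(real^'r::finite) set \<Rightarrow> real \<Rightarrow> real \<Rightarrow> (real^'r \<Rightarrow> real) set" where
  "holder_class T \<beta> K = {f. \<exists>D. partials_within T \<beta> f D \<and>
     (\<Sum>\<alpha> | real (mi_order \<alpha>) < \<beta>. SUP x\<in>T. ennreal \<bar>D \<alpha> x\<bar>) +
     (\<Sum>\<alpha> | real (mi_order \<alpha>) = \<beta> - 1.
        SUP (x, y)\<in>{(x, y). x \<in> T \<and> y \<in> T \<and> x \<noteq> y}. ennreal (\<bar>D \<alpha> x - D \<alpha> y\<bar> / infnorm (x - y)))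
     \<le> ennreal K}"

definition generator_class :: "nat \<Rightarrow> real \<Rightarrow> real \<Rightarrow> (real^'z::finite \<Rightarrow> real^'d::finite) set" where
  "generator_class dg \<beta> K = {g. g \<in> borel_measurable borel \<and>
     (\<forall>j. (\<exists>S. card S = dg \<and> (\<forall>z z'. (\<forall>i\<in>S. z $ i = z' $ i) \<longrightarrow> g z $ j = g z' $ j)) \<and>
          (\<lambda>z. g z $ j) \<in> holder_class (cbox 0 1) \<beta> K)}"


section \<open>Sparse ReLU networks\<close>

text \<open>
  Since widths vary, vectors of length \<open>k\<close> are functions on \<^typ>\<open>nat\<close> of which only the
  values below \<open>k\<close> matter, and similarly for matrices.
\<close>

definition relu :: "real \<Rightarrow> real" where
  "relu x = max x 0"

primrec net ::
  "(nat \<Rightarrow> nat) \<Rightarrow> (nat \<Rightarrow> nat \<Rightarrow> nat \<Rightarrow> real) \<Rightarrow> (nat \<Rightarrow> nat \<Rightarrow> real) \<Rightarrow> nat \<Rightarrow>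
     (nat \<Rightarrow> real) \<Rightarrow> nat \<Rightarrow> real" where
  "net p W v 0 x = (\<lambda>i. \<Sum>j<p 0. W 0 i j * x j)"
| "net p W v (Suc l) x =
     (\<lambda>i. \<Sum>j<p (Suc l). W (Suc l) i j * relu (net p W v l x j - v (Suc l) j))"

definition relu_networks ::
  "nat \<Rightarrow> (nat \<Rightarrow> nat) \<Rightarrow> real \<Rightarrow> real \<Rightarrow> ((nat \<Rightarrow> real) \<Rightarrow> nat \<Rightarrow> real) set" where
  "relu_networks L p s F = {h. \<exists>W v. h = net p W v L \<and>
     (\<forall>l\<le>L. \<forall>i<p (Suc l). \<forall>j<p l. \<bar>W l i j\<bar> \<le> 1) \<and>
     (\<forall>l\<in>{1..L}. \<forall>i<p l. \<bar>v l i\<bar> \<le> 1) \<and>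
     real (card {(l, i, j). l \<le> L \<and> i < p (Suc l) \<and> j < p l \<and> W l i j \<noteq> 0} +
           card {(l, i). l \<in> {1..L} \<and> i < p l \<and> v l i \<noteq> 0}) \<le> s \<and>
     (\<forall>x. (\<forall>j<p 0. 0 \<le> x j \<and> x j \<le> 1) \<longrightarrow> (\<forall>i<p (Suc L). \<bar>h x i\<bar> \<le> F))}"

text \<open>
  An enumeration of the coordinates of \<^typ>\<open>real^'d\<close>. Its choice is immaterial, because
  \<open>relu_networks\<close> is invariant under permuting the columns of \<open>W 0\<close>.
\<close>

definition coords :: "real^'d::finite \<Rightarrow> nat \<Rightarrow> real" where
  "coords x i = x $ from_nat_into UNIV i"

definition critic_class :: "nat \<Rightarrow> (nat \<Rightarrow> nat) \<Rightarrow> real \<Rightarrow> real \<Rightarrow> (real^'d::finite \<Rightarrow> real) set" where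
  "critic_class L p s F = {\<lambda>x. h (coords x) 0 |h. h \<in> relu_networks L p s F}"

definition rate :: "real \<Rightarrow> nat \<Rightarrow> nat \<Rightarrow> real" where
  "rate \<gamma> d n = real n powr (- (2 * \<gamma> / (2 * \<gamma> + real d)))"


section \<open>The network-based Wasserstein functional\<close>

text \<open>
  The supremum runs over the critics whose expectation under \<open>g(Z)\<close> exists; this excludes the
  default value 0 of the Bochner integral. The expectation under \<open>X\<close> always exists
  for \<open>X\<close> bounded.
\<close>

definition critic_wasserstein ::
  "'o measure \<Rightarrow> ('o \<Rightarrow> real^'d::finite) \<Rightarrow> ('o \<Rightarrow> real^'z::finite) \<Rightarrow> (real^'d \<Rightarrow> real) set \<Rightarrow>
     (real^'z \<Rightarrow> real^'d) \<Rightarrow> ereal" where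
  "critic_wasserstein M X Z C g =
     (SUP f\<in>{f\<in>C. 1-lipschitz_on UNIV f \<and> integrable M (\<lambda>\<omega>. f (g (Z \<omega>)))}.
        ereal ((\<integral>\<omega>. f (X \<omega>) \<partial>M) - (\<integral>\<omega>. f (g (Z \<omega>)) \<partial>M)))"


section \<open>Random functions and convergence in distribution\<close>

text \<open>
  \<open>G\<close> is a random measurable function independent of \<open>Z\<close>: it is jointly measurable with respect to
  a sub-sigma-algebra \<open>A\<close> that is independent of \<open>Z\<close> (e.g. the one generated by the training
  data). Independence of \<open>Z\<close> from all evaluations \<open>\<lambda>\<omega>. G \<omega> z\<close> would be too weak: for atomless \<open>Z\<close>
  it holds for the indicator of \<open>z = Z \<omega>\<close>, which depends on \<open>Z\<close>.
\<close>

definition indep_random_function ::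
  "'o measure \<Rightarrow> ('o \<Rightarrow> 'z::topological_space) \<Rightarrow> ('o \<Rightarrow> 'z \<Rightarrow> 'b::topological_space) \<Rightarrow> bool" where
  "indep_random_function M Z G \<longleftrightarrow> (\<exists>A. subalgebra M A \<and>
     (\<lambda>(\<omega>, z). G \<omega> z) \<in> borel_measurable (A \<Otimes>\<^sub>M borel) \<and>
     prob_space.indep_set M (sets A) {Z -` B \<inter> space M |B. B \<in> sets borel})"

definition converges_in_distribution ::
  "'o measure \<Rightarrow> (nat \<Rightarrow> 'o \<Rightarrow> 'b::topological_space) \<Rightarrow> ('o \<Rightarrow> 'b) \<Rightarrow> bool" where
  "converges_in_distribution M Y Y' \<longleftrightarrow>
     (\<forall>\<phi> :: 'b \<Rightarrow> real. continuous_on UNIV \<phi> \<and> bounded (range \<phi>) \<longrightarrow>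
        (\<lambda>n. \<integral>\<omega>. \<phi> (Y n \<omega>) \<partial>M) \<longlonglongrightarrow> (\<integral>\<omega>. \<phi> (Y' \<omega>) \<partial>M))"

end

(* E W(ghat_n) dominates E f(X) - E f(ghat_n(Z)) for each single critic f. Every bump
   x |-> max(0, eps - |x - t|_1), scaled by a constant depending on t only, is a network with two
   hidden layers, and padding it to depth L costs L + O(1) nonzero parameters, so for large n it
   belongs to the critic class. Hence liminf E bump(ghat_n(Z) - t) >= E bump(X - t) for all t and
   eps. Mixing these bounds over t with weight phi(t) and letting eps tend to 0 gives
   liminf E phi(ghat_n(Z)) >= E phi(X) for every nonnegative continuous phi. Applying this to
   B + phi and B - phi for |phi| <= B yields convergence in distribution. *)

theory Submission
  imports Defs
begin

section \<open>Bump functions and their integrals\<close>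

text \<open>The l1 norm is used because each absolute value is a sum of two ReLUs: a bump is then
  exactly a ReLU network, and no approximation error arises.\<close>

definition bump :: "real \<Rightarrow> real^'d::finite \<Rightarrow> real" where
  "bump \<epsilon> y = max 0 (\<epsilon> - (\<Sum>i\<in>UNIV. \<bar>y $ i\<bar>))"

lemma bump_nonneg: "0 \<le> bump \<epsilon> y"
  by (simp add: bump_def)

lemma bump_le: "0 < \<epsilon> \<Longrightarrow> bump \<epsilon> y \<le> \<epsilon>"
  by (simp add: bump_def sum_nonneg)

lemma bump_eq_0: "\<epsilon> \<le> norm y \<Longrightarrow> bump \<epsilon> y = 0"
  using norm_le_l1_cart[of y] by (simp add: bump_def)

lemma bump_minus: "bump \<epsilon> (- y) = bump \<epsilon> y"
  by (simp add: bump_def)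

lemma measurable_bump [measurable]: "bump \<epsilon> \<in> borel_measurable borel"
  unfolding bump_def by (intro borel_measurable_continuous_onI continuous_intros)

text \<open>Cutting off at 0 is a contraction, and every coordinate is 1-Lipschitz for the Euclidean
  norm. The constant is crude; dividing the critic by a large enough \<open>R\<close> compensates
  for it.\<close>

lemma bump_lipschitz: "\<bar>bump \<epsilon> x - bump \<epsilon> y\<bar> \<le> real CARD('d) * norm (x - y)"
  for x y :: "real^'d::finite"
proof -
  have "\<bar>bump \<epsilon> x - bump \<epsilon> y\<bar> \<le> \<bar>(\<Sum>i\<in>UNIV. \<bar>x $ i\<bar>) - (\<Sum>i\<in>UNIV. \<bar>y $ i\<bar>)\<bar>"
    unfolding bump_def by linarith
  also have "\<dots> \<le> (\<Sum>i\<in>UNIV. \<bar>(x - y) $ i\<bar>)"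
    unfolding sum_subtractf[symmetric] by (intro order_trans[OF sum_abs] sum_mono) auto
  also have "\<dots> \<le> (\<Sum>i\<in>(UNIV::'d set). norm (x - y))"
    by (intro sum_mono component_le_norm_cart)
  finally show ?thesis by simp
qed

text \<open>The l1 norm dominates the Euclidean norm, so the bump vanishes outside a ball. Finite
  and, by the next lemma, positive mass can be cancelled from the mixed inequality.\<close>

lemma nn_integral_bump_finite:
  assumes "0 < \<epsilon>"
  shows "(\<integral>\<^sup>+y. ennreal (bump \<epsilon> (y :: real^'d::finite)) \<partial>lborel) < \<infinity>"
proof -
  have "(\<integral>\<^sup>+y. ennreal (bump \<epsilon> (y :: real^'d)) \<partial>lborel)
      \<le> (\<integral>\<^sup>+y. ennreal \<epsilon> * indicator (cball 0 \<epsilon>) (y :: real^'d) \<partial>lborel)"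
    using bump_le[OF assms]
    by (intro nn_integral_mono) (auto simp: indicator_def bump_eq_0 intro: ennreal_leI)
  also have "\<dots> < \<infinity>"
    using emeasure_bounded_finite[of "cball 0 \<epsilon> :: (real^'d) set"]
    by (simp add: nn_integral_cmult_indicator ennreal_mult_less_top)
  finally show ?thesis .
qed

lemma nn_integral_bump_pos:
  assumes "0 < \<epsilon>"
  shows "0 < (\<integral>\<^sup>+y. ennreal (bump \<epsilon> (y :: real^'d::finite)) \<partial>lborel)"
proof -
  \<comment> \<open>With this radius the Lipschitz bound permits a drop of at most
    \<open>\<epsilon> / 2\<close> below the peak value \<open>\<epsilon>\<close>.\<close>
  define r where "r = \<epsilon> / (2 * real CARD('d))"
  have r: "0 < r" using assms by (simp add: r_def)
  have ge: "\<epsilon> / 2 \<le> bump \<epsilon> y" if "norm y < r" for y :: "real^'d"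
  proof -
    have "bump \<epsilon> (0 :: real^'d) = \<epsilon>" using assms by (simp add: bump_def)
    moreover have "real CARD('d) * norm (0 - y) \<le> \<epsilon> / 2"
      using that by (simp add: r_def field_simps)
    ultimately show ?thesis using bump_lipschitz[of \<epsilon> 0 y] by linarith
  qed
  have "0 < emeasure lborel (ball 0 r :: (real^'d) set)"
    using content_ball_pos[OF r, of "0 :: real^'d"]
    by (metis emeasure_lborel_ball_finite ennreal_less_zero_iff less_infinityE measure_def
        emeasure_eq_ennreal_measure infinity_ennreal_def less_irrefl)
  hence "0 < ennreal (\<epsilon> / 2) * emeasure lborel (ball 0 r :: (real^'d) set)"
    using assms by (simp add: ennreal_zero_less_mult_iff)
  also have "\<dots> = (\<integral>\<^sup>+y. ennreal (\<epsilon> / 2) * indicator (ball 0 r) (y :: real^'d) \<partial>lborel)"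
    by (simp add: nn_integral_cmult_indicator)
  also have "\<dots> \<le> (\<integral>\<^sup>+y. ennreal (bump \<epsilon> (y :: real^'d)) \<partial>lborel)"
    using ge by (intro nn_integral_mono) (auto simp: indicator_def intro: ennreal_leI)
  finally show ?thesis .
qed

text \<open>The integral runs over the centre, so translation invariance is combined with evenness
  of the bump. Mixtures of bumps thus have the same normalization at every point.\<close>

lemma nn_integral_bump_shift:
  fixes x :: "real^'d::finite"
  shows "(\<integral>\<^sup>+t. ennreal (bump \<epsilon> (x - t)) \<partial>lborel) = (\<integral>\<^sup>+y. ennreal (bump \<epsilon> (y :: real^'d)) \<partial>lborel)"
proof -
  have "(\<integral>\<^sup>+y. ennreal (bump \<epsilon> (y :: real^'d)) \<partial>lborel) = (\<integral>\<^sup>+y. ennreal (bump \<epsilon> y) \<partial>distr lborel borel ((+) (- x)))"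
    by (simp add: lborel_distr_plus)
  also have "\<dots> = (\<integral>\<^sup>+t. ennreal (bump \<epsilon> (- x + t)) \<partial>lborel)"
    by (simp add: nn_integral_distr)
  also have "\<dots> = (\<integral>\<^sup>+t. ennreal (bump \<epsilon> (x - t)) \<partial>lborel)"
    by (intro nn_integral_cong) (metis bump_minus minus_diff_eq uminus_add_conv_diff)
  finally show ?thesis by simp
qed

section \<open>Mixtures of bumps as test functions\<close>

text \<open>Only lower bounds are assumed: mixing the bumps with weight \<open>\<phi>\<close> over a large ball of centres gives a
  function that is at most \<open>\<phi> + \<delta>\<close> on the whole space and at least \<open>\<phi> - \<delta>\<close> where \<open>X\<close> lives,
  up to normalization. So no tightness of \<open>Y\<close> is needed.\<close>

lemma nn_integral_le_liminf_of_bumps: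
  fixes X :: "'o \<Rightarrow> real^'d::finite" and \<phi> :: "real^'d \<Rightarrow> real"
  assumes M: "prob_space M"
    and X [measurable]: "X \<in> borel_measurable M"
    and Y [measurable]: "\<And>n. Y n \<in> borel_measurable M"
    and bX: "\<And>\<omega>. \<omega> \<in> space M \<Longrightarrow> norm (X \<omega>) \<le> r"
    and bump: "\<And>t \<epsilon>. 0 < \<epsilon> \<Longrightarrow> \<epsilon> \<le> 1 \<Longrightarrow>
       (\<integral>\<^sup>+\<omega>. ennreal (bump \<epsilon> (X \<omega> - t)) \<partial>M) \<le> liminf (\<lambda>n. \<integral>\<^sup>+\<omega>. ennreal (bump \<epsilon> (Y n \<omega> - t)) \<partial>M)"
    and cont: "continuous_on UNIV \<phi>" and nonneg: "\<And>x. 0 \<le> \<phi> x"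
  shows "(\<integral>\<^sup>+\<omega>. ennreal (\<phi> (X \<omega>)) \<partial>M) \<le> liminf (\<lambda>n. \<integral>\<^sup>+\<omega>. ennreal (\<phi> (Y n \<omega>)) \<partial>M)"
proof (rule ennreal_le_epsilon)
  fix e :: real assume e: "0 < e"
  interpret prob_space M by fact
  have [measurable]: "\<phi> \<in> borel_measurable borel"
    using cont by (rule borel_measurable_continuous_onI)
  \<comment> \<open>Half of \<open>e\<close>, since the error enters twice: in \<open>lower\<close>
    for \<open>X\<close> and in \<open>upper\<close> for \<open>Y n\<close>.\<close>
  define \<delta> where "\<delta> = e / 2"
  have \<delta>: "0 < \<delta>" using e by (simp add: \<delta>_def)
  \<comment> \<open>Centres range over the ball of radius \<open>r + 1\<close> and a bump reaches at
    most 1 further, so uniform continuity on this compact ball covers every pair that is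
    compared.\<close>
  have "uniformly_continuous_on (cball 0 (r + 2)) \<phi>"
    by (intro compact_uniformly_continuous continuous_on_subset[OF cont]) auto
  then obtain \<epsilon>' where \<epsilon>': "0 < \<epsilon>'"
    "\<And>x y. x \<in> cball 0 (r + 2) \<Longrightarrow> y \<in> cball 0 (r + 2) \<Longrightarrow> dist y x < \<epsilon>' \<Longrightarrow> dist (\<phi> y) (\<phi> x) < \<delta>"
    unfolding uniformly_continuous_on_def using \<delta> by metis
  define \<epsilon> where "\<epsilon> = min \<epsilon>' 1"
  have \<epsilon>: "0 < \<epsilon>" "\<epsilon> \<le> 1" using \<epsilon>' by (auto simp: \<epsilon>_def)
  have close: "\<bar>\<phi> x - \<phi> t\<bar> < \<delta>" if "norm x \<le> r + 2" "norm t \<le> r + 2" "norm (x - t) < \<epsilon>" for x t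
    using \<epsilon>'(2)[of t x] that by (auto simp: \<epsilon>_def dist_norm)
  let ?T = "cball 0 (r + 1) :: (real^'d) set"
  have [measurable]: "?T \<in> sets borel" by simp
  let ?w = "\<lambda>t. ennreal (\<phi> t) * indicator ?T t"
  let ?k = "\<lambda>x t :: real^'d. ennreal (bump \<epsilon> (x - t))"
  define C where "C = (\<integral>\<^sup>+y. ennreal (bump \<epsilon> (y :: real^'d)) \<partial>lborel)"
  have C: "0 < C" "C < \<infinity>" "\<And>x. (\<integral>\<^sup>+t. ?k x t \<partial>lborel) = C"
    using nn_integral_bump_pos[OF \<epsilon>(1)] nn_integral_bump_finite[OF \<epsilon>(1)]
    by (simp_all add: C_def nn_integral_bump_shift)
  have upper: "(\<integral>\<^sup>+t. ?w t * ?k x t \<partial>lborel) \<le> C * ennreal (\<phi> x) + C * ennreal \<delta>" for x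
  proof -
    have "?w t * ?k x t \<le> ennreal (\<phi> x + \<delta>) * ?k x t" for t
    \<comment> \<open>Outside \<open>?T\<close> the weight vanishes, and at distance at least
      \<open>\<epsilon>\<close> the bump does. Either way the left side is 0, however far out
      \<open>x\<close> lies.\<close>
    proof (cases "t \<in> ?T \<and> norm (x - t) < \<epsilon>")
      case True
      have "norm x \<le> norm t + norm (x - t)" by (metis add.commute diff_add_cancel norm_triangle_ineq)
      hence "\<phi> t \<le> \<phi> x + \<delta>" using close[of x t] True \<epsilon> by auto
      thus ?thesis using True by (auto intro!: mult_right_mono ennreal_leI)
    qed (auto simp: bump_eq_0 not_less)
    hence "(\<integral>\<^sup>+t. ?w t * ?k x t \<partial>lborel) \<le> (\<integral>\<^sup>+t. ennreal (\<phi> x + \<delta>) * ?k x t \<partial>lborel)"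
      by (intro nn_integral_mono)
    also have "\<dots> = C * ennreal (\<phi> x) + C * ennreal \<delta>"
      using nonneg[of x] \<delta> by (simp add: nn_integral_cmult C distrib_left mult.commute nn_integral_add distrib_right)
    finally show ?thesis .
  qed
  have lower: "C * ennreal (\<phi> x) \<le> (\<integral>\<^sup>+t. ?w t * ?k x t \<partial>lborel) + C * ennreal \<delta>" if "norm x \<le> r" for x
  proof -
    have *: "ennreal (\<phi> x) * ?k x t \<le> ?w t * ?k x t + ennreal \<delta> * ?k x t" for t
    proof (cases "norm (x - t) < \<epsilon>")
      case True
      have "norm t \<le> norm x + norm (x - t)" by (metis norm_minus_commute norm_triangle_sub)
      hence t: "norm t \<le> r + 1" using True that \<epsilon> by linarith
      hence "\<phi> x \<le> \<phi> t + \<delta>" using close[of x t] True \<epsilon> that by auto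
      hence "ennreal (\<phi> x) \<le> ennreal (\<phi> t) + ennreal \<delta>"
        using nonneg[of t] \<delta> by (simp add: ennreal_plus[symmetric] ennreal_leI del: ennreal_plus)
      thus ?thesis using t by (auto simp flip: distrib_right intro: mult_right_mono)
    qed (auto simp: bump_eq_0 not_less)
    have "C * ennreal (\<phi> x) = (\<integral>\<^sup>+t. ennreal (\<phi> x) * ?k x t \<partial>lborel)"
      by (simp add: nn_integral_cmult C mult.commute)
    also have "\<dots> \<le> (\<integral>\<^sup>+t. ?w t * ?k x t + ennreal \<delta> * ?k x t \<partial>lborel)"
      by (intro nn_integral_mono *)
    also have "\<dots> = (\<integral>\<^sup>+t. ?w t * ?k x t \<partial>lborel) + C * ennreal \<delta>"
      by (subst nn_integral_add) (simp_all add: nn_integral_cmult C mult.commute[of C])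
    finally show ?thesis .
  qed
  have fubini: "(\<integral>\<^sup>+\<omega>. \<integral>\<^sup>+t. ?w t * ?k (V \<omega>) t \<partial>lborel \<partial>M) = (\<integral>\<^sup>+t. ?w t * (\<integral>\<^sup>+\<omega>. ?k (V \<omega>) t \<partial>M) \<partial>lborel)"
    if [measurable]: "V \<in> borel_measurable M" for V
  proof -
    interpret pair_sigma_finite lborel M by unfold_locales
    have "(\<integral>\<^sup>+\<omega>. \<integral>\<^sup>+t. ?w t * ?k (V \<omega>) t \<partial>lborel \<partial>M) = (\<integral>\<^sup>+t. \<integral>\<^sup>+\<omega>. ?w t * ?k (V \<omega>) t \<partial>M \<partial>lborel)"
      by (rule Fubini') measurable
    thus ?thesis by (simp add: nn_integral_cmult)
  qed
  let ?I = "\<lambda>V. \<integral>\<^sup>+\<omega>. ennreal (\<phi> (V \<omega>)) \<partial>M"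
  have "C * ?I X = (\<integral>\<^sup>+\<omega>. C * ennreal (\<phi> (X \<omega>)) \<partial>M)"
    by (simp add: nn_integral_cmult)
  also have "\<dots> \<le> (\<integral>\<^sup>+\<omega>. (\<integral>\<^sup>+t. ?w t * ?k (X \<omega>) t \<partial>lborel) + C * ennreal \<delta> \<partial>M)"
    using bX by (intro nn_integral_mono lower) auto
  also have "\<dots> = (\<integral>\<^sup>+t. ?w t * (\<integral>\<^sup>+\<omega>. ?k (X \<omega>) t \<partial>M) \<partial>lborel) + C * ennreal \<delta>"
    by (subst nn_integral_add) (simp_all add: emeasure_space_1 fubini)
  also have "(\<integral>\<^sup>+t. ?w t * (\<integral>\<^sup>+\<omega>. ?k (X \<omega>) t \<partial>M) \<partial>lborel)
      \<le> (\<integral>\<^sup>+t. liminf (\<lambda>n. ?w t * (\<integral>\<^sup>+\<omega>. ?k (Y n \<omega>) t \<partial>M)) \<partial>lborel)"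
  proof (intro nn_integral_mono)
    fix t :: "real^'d"
    have "?w t * (\<integral>\<^sup>+\<omega>. ?k (X \<omega>) t \<partial>M) \<le> ?w t * liminf (\<lambda>n. \<integral>\<^sup>+\<omega>. ?k (Y n \<omega>) t \<partial>M)"
      using bump[OF \<epsilon>] by (intro mult_left_mono) auto
    \<comment> \<open>The weight \<open>?w t\<close> is finite, so multiplication by it is
      continuous on \<open>ennreal\<close> and passes through the liminf.\<close>
    also have "\<dots> = liminf (\<lambda>n. ?w t * (\<integral>\<^sup>+\<omega>. ?k (Y n \<omega>) t \<partial>M))"
      by (intro Liminf_compose_continuous_mono[symmetric, where f="\<lambda>x. ?w t * x"]
          ennreal_continuous_on_cmult monoI mult_left_mono continuous_on_id) (auto simp: indicator_def)
    finally show "?w t * (\<integral>\<^sup>+\<omega>. ?k (X \<omega>) t \<partial>M) \<le> liminf (\<lambda>n. ?w t * (\<integral>\<^sup>+\<omega>. ?k (Y n \<omega>) t \<partial>M))" .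
  qed
  \<comment> \<open>Fatou's lemma, with respect to the centre \<open>t\<close>.\<close>
  also have "\<dots> \<le> liminf (\<lambda>n. \<integral>\<^sup>+t. ?w t * (\<integral>\<^sup>+\<omega>. ?k (Y n \<omega>) t \<partial>M) \<partial>lborel)"
    by (intro nn_integral_liminf) simp
  also have "\<dots> \<le> liminf (\<lambda>n. C * ?I (Y n) + C * ennreal \<delta>)"
  proof (intro Liminf_mono always_eventually allI)
    fix n
    have "(\<integral>\<^sup>+t. ?w t * (\<integral>\<^sup>+\<omega>. ?k (Y n \<omega>) t \<partial>M) \<partial>lborel)
        \<le> (\<integral>\<^sup>+\<omega>. C * ennreal (\<phi> (Y n \<omega>)) + C * ennreal \<delta> \<partial>M)"
      unfolding fubini[OF Y, symmetric] by (intro nn_integral_mono upper)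
    also have "\<dots> = C * ?I (Y n) + C * ennreal \<delta>"
      by (simp add: nn_integral_add nn_integral_cmult emeasure_space_1)
    finally show "(\<integral>\<^sup>+t. ?w t * (\<integral>\<^sup>+\<omega>. ?k (Y n \<omega>) t \<partial>M) \<partial>lborel) \<le> C * ?I (Y n) + C * ennreal \<delta>" .
  qed
  also have "\<dots> = C * liminf (\<lambda>n. ?I (Y n)) + C * ennreal \<delta>"
    using C(2) by (intro Liminf_compose_continuous_mono[where f="\<lambda>x. C * x + C * ennreal \<delta>"]
        monoI add_right_mono mult_left_mono continuous_on_add_ennreal ennreal_continuous_on_cmult
        continuous_on_id continuous_on_const) auto
  finally have "C * ?I X \<le> (C * liminf (\<lambda>n. ?I (Y n)) + C * ennreal \<delta>) + C * ennreal \<delta>"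
    by (simp add: add_right_mono)
  also have "\<dots> = C * (liminf (\<lambda>n. ?I (Y n)) + ennreal e)"
    using \<delta> by (simp add: distrib_left[symmetric] add.assoc ennreal_plus[symmetric] \<delta>_def del: ennreal_plus)
  finally show "?I X \<le> liminf (\<lambda>n. ?I (Y n)) + ennreal e"
    using C by (simp add: ennreal_mult_le_mult_iff)
qed

section \<open>Bumps as ReLU networks\<close>

lemma sum_lessThan_add:
  "(\<Sum>j<m + n. f j) = (\<Sum>j<m. f j) + (\<Sum>j<n. f (m + j) :: 'a::comm_monoid_add)" for m n :: nat
  by (induction n) (auto simp: add.assoc)

lemma sum_coords: "(\<Sum>i<CARD('d). f (coords x i)) = (\<Sum>i\<in>UNIV. f (x $ i))" for x :: "real^'d::finite"
  unfolding coords_def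
  by (rule sum.reindex_bij_betw[OF bij_betw_from_nat_into_finite, of UNIV "\<lambda>i. f (x $ i)"]) simp

text \<open>The first hidden layer holds the positive and negative parts of \<open>(x - t) / R\<close>, the second one
  \<open>bump \<epsilon> (x - t) / R\<close>. The remaining layers copy this value, which the ReLU leaves unchanged
  since it is nonnegative; each of them costs only one nonzero weight.\<close>

definition bump_weight :: "nat \<Rightarrow> real \<Rightarrow> nat \<Rightarrow> nat \<Rightarrow> nat \<Rightarrow> real" where
  "bump_weight d R l i j =
    (if l = 0 then (if i < d \<and> j = i then 1 / R else if d \<le> i \<and> i < 2 * d \<and> j = i - d then - 1 / R else 0)
     else if l = 1 then (if i = 0 \<and> j < 2 * d then - 1 else 0)
     else (if i = 0 \<and> j = 0 then 1 else 0))"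

text \<open>Biases are subtracted before the activation, hence the negative sign of
  \<open>\<epsilon>\<close>.\<close>

definition bump_bias :: "nat \<Rightarrow> real \<Rightarrow> real \<Rightarrow> (nat \<Rightarrow> real) \<Rightarrow> nat \<Rightarrow> nat \<Rightarrow> real" where
  "bump_bias d R \<epsilon> t l i =
    (if l = 1 then (if i < d then t i / R else if i < 2 * d then - t (i - d) / R else 0)
     else if l = 2 \<and> i = 0 then - \<epsilon> / R else 0)"

text \<open>The ReLU is positively homogeneous, so the factor \<open>1 / R\<close> placed in the
  first matrix reappears unchanged in the output. Surplus neurons receive zero outgoing weights, so
  lower bounds on the hidden widths suffice.\<close>

lemma net_bump:
  assumes "p 0 = d" "2 * d \<le> p 1" "\<And>i. 2 \<le> i \<Longrightarrow> i \<le> L \<Longrightarrow> 1 \<le> p i" "2 \<le> L" "0 < R"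
  shows "net p (bump_weight d R) (bump_bias d R \<epsilon> t) L x 0 = max 0 (\<epsilon> - (\<Sum>j<d. \<bar>x j - t j\<bar>)) / R"
  using assms(4,3)
proof (induction L rule: dec_induct)
  case base
  let ?n = "net p (bump_weight d R) (bump_bias d R \<epsilon> t)"
  have 0: "?n 0 x i = (if i < d then x i / R else - x (i - d) / R)" if "i < 2 * d" for i
  proof (cases "i < d")
    case True
    have "?n 0 x i = (\<Sum>j<d. bump_weight d R 0 i j * x j)"
      by (simp add: assms(1))
    also have "\<dots> = (\<Sum>j<d. if j = i then x i / R else 0)"
      using True that by (intro sum.cong) (auto simp: bump_weight_def)
    finally have "?n 0 x i = (\<Sum>j<d. if j = i then x i / R else 0)" .
    thus ?thesis using True by simp
  next
    case False
    have "?n 0 x i = (\<Sum>j<d. bump_weight d R 0 i j * x j)"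
      by (simp add: assms(1))
    also have "\<dots> = (\<Sum>j<d. if j = i - d then - x (i - d) / R else 0)"
      using False that by (intro sum.cong) (auto simp: bump_weight_def)
    finally have "?n 0 x i = (\<Sum>j<d. if j = i - d then - x (i - d) / R else 0)" .
    thus ?thesis using False that by (simp add: less_diff_conv2)
  qed
  let ?r = "\<lambda>j. relu (?n 0 x j - bump_bias d R \<epsilon> t 1 j)"
  have "?n 1 x 0 = (\<Sum>j<p 1. bump_weight d R 1 0 j * ?r j)"
    by simp
  \<comment> \<open>Neurons from index \<open>2 * d\<close> on have outgoing weight 0 and drop
    out.\<close>
  also have "\<dots> = (\<Sum>j<d + d. bump_weight d R 1 0 j * ?r j)"
    using assms(2) by (intro sum.mono_neutral_right) (auto simp: bump_weight_def)
  also have "\<dots> = (\<Sum>j<d + d. - ?r j)"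
    by (intro sum.cong) (auto simp: bump_weight_def)
  \<comment> \<open>Splitting at \<open>d\<close> pairs the positive with the negative part of each
    coordinate; the two add up to its absolute value.\<close>
  also have "\<dots> = (\<Sum>j<d. - (?r j + ?r (d + j)))"
    unfolding sum_lessThan_add sum.distrib[symmetric] by (intro sum.cong refl) linarith
  also have "\<dots> = (\<Sum>j<d. - (\<bar>x j - t j\<bar> / R))"
  proof (intro sum.cong refl)
    fix j assume "j \<in> {..<d}"
    define q where "q = (x j - t j) / R"
    have "?r j = max q 0" "?r (d + j) = max (- q) 0"
      using \<open>j \<in> {..<d}\<close>
      by (simp_all add: 0 bump_bias_def relu_def diff_divide_distrib q_def del: net.simps)
    moreover have "\<bar>x j - t j\<bar> / R = \<bar>q\<bar>" using assms(5) by (simp add: q_def)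
    ultimately show "- (?r j + ?r (d + j)) = - (\<bar>x j - t j\<bar> / R)"
      by linarith
  qed
  also have "\<dots> = - (\<Sum>j<d. \<bar>x j - t j\<bar>) / R"
    by (simp add: sum_negf sum_divide_distrib)
  finally have 1: "?n 1 x 0 = - (\<Sum>j<d. \<bar>x j - t j\<bar>) / R" .
  have "?n 2 x 0 = (\<Sum>j<p 2. bump_weight d R 2 0 j * relu (?n 1 x j - bump_bias d R \<epsilon> t 2 j))"
    by (simp add: numeral_2_eq_2)
  also have "\<dots> = (\<Sum>j<p 2. if j = 0 then relu (?n 1 x 0 + \<epsilon> / R) else 0)"
    by (intro sum.cong) (auto simp: bump_weight_def bump_bias_def simp del: net.simps)
  also have "\<dots> = relu (?n 1 x 0 + \<epsilon> / R)"
    using base[of 2] by simp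
  finally show ?case
    using assms(5) unfolding 1 by (simp add: relu_def max_def field_simps)
next
  case (step l)
  let ?n = "net p (bump_weight d R) (bump_bias d R \<epsilon> t)"
  have "?n (Suc l) x 0 = (\<Sum>j<p (Suc l). if j = 0 then relu (?n l x 0) else 0)"
    unfolding net.simps(2) using step.hyps
    by (intro sum.cong) (auto simp: bump_weight_def bump_bias_def)
  also have "\<dots> = relu (?n l x 0)"
    using step.prems[of "Suc l"] step.hyps by simp
  also have "\<dots> = ?n l x 0"
    using step assms(5) by (simp add: relu_def)
  finally show ?case using step by simp
qed

text \<open>Division by \<open>R\<close> brings the weights and biases into [-1, 1]. The nonzero
  parameters are 2d weights in each of the first two matrices, one weight in each of the
  \<open>L - 1\<close> others, and at most 2d + 1 biases: 6d + L in total.\<close>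

lemma bump_in_critic_class:
  fixes t :: "real^'d::finite"
  assumes \<epsilon>: "0 < \<epsilon>" "\<epsilon> \<le> 1" and R: "1 \<le> R" "\<And>i. \<bar>t $ i\<bar> \<le> R"
    and L: "2 \<le> L" and p: "p 0 = CARD('d)" "p (Suc L) = 1" "\<And>i. i \<in> {1..L} \<Longrightarrow> 2 * CARD('d) \<le> p i"
    and s: "6 * real CARD('d) + real L \<le> s" and F: "1 \<le> F"
  shows "(\<lambda>x. bump \<epsilon> (x - t) / R) \<in> critic_class L p s F"
proof -
  let ?d = "CARD('d)"
  define W where "W = bump_weight ?d R"
  define v where "v = bump_bias ?d R \<epsilon> (coords t)"
  have t: "\<bar>coords t i\<bar> \<le> R" for i
    using R(2) by (simp add: coords_def)
  have d: "0 < ?d" by simp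
  have p1: "1 \<le> p i" if "2 \<le> i" "i \<le> L" for i
    using p(3)[of i] that d by (simp add: Suc_le_eq del: zero_less_card_finite)
  have net: "net p W v L x 0 = max 0 (\<epsilon> - (\<Sum>j<?d. \<bar>x j - coords t j\<bar>)) / R" for x
    unfolding W_def v_def using R p1 p L by (intro net_bump) auto
  let ?SW = "{(l, i, j). l \<le> L \<and> i < p (Suc l) \<and> j < p l \<and> W l i j \<noteq> 0}"
  let ?Sv = "{(l, i). l \<in> {1..L} \<and> i < p l \<and> v l i \<noteq> 0}"
  \<comment> \<open>The possible positions of nonzero weights: \<open>?A\<close> in the first
    matrix, \<open>?B\<close> in the second, \<open>?C\<close> in the later ones.\<close>
  let ?A = "(\<lambda>i. (0 :: nat, i, if i < ?d then i else i - ?d)) ` {..<2 * ?d}"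
  let ?B = "(\<lambda>j. (1 :: nat, 0 :: nat, j)) ` {..<2 * ?d}"
  let ?C = "(\<lambda>l. (l, 0 :: nat, 0 :: nat)) ` {2..L}"
  have "x \<in> ?A" if "x \<in> ?SW" "x \<notin> ?B" "x \<notin> ?C" for x
  proof -
    obtain l i j where x: "x = (l, i, j)" by (cases x)
    have "l = 0" "i < 2 * ?d" "j = (if i < ?d then i else i - ?d)"
      using that by (auto simp: x W_def bump_weight_def image_iff split: if_split_asm)
    thus ?thesis unfolding x by (intro rev_image_eqI[of i]) simp_all
  qed
  hence "?SW \<subseteq> ?A \<union> (?B \<union> ?C)" by blast
  hence "card ?SW \<le> card (?A \<union> (?B \<union> ?C))"
    by (rule card_mono[rotated]) simp
  moreover have "card ?A \<le> 2 * ?d" "card ?B \<le> 2 * ?d" "card ?C \<le> L - 1"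
    by (rule order_trans[OF card_image_le]; simp)+
  ultimately have SW: "card ?SW \<le> 4 * ?d + (L - 1)"
    using card_Un_le[of ?A "?B \<union> ?C"] card_Un_le[of ?B ?C] by linarith
  have "?Sv \<subseteq> insert (2, 0) (Pair 1 ` {..<2 * ?d})"
    by (auto simp: v_def bump_bias_def split: if_split_asm)
  hence "card ?Sv \<le> card (insert (2, 0) (Pair (1 :: nat) ` {..<2 * ?d}))"
    by (rule card_mono[rotated]) simp
  also have "\<dots> \<le> Suc (2 * ?d)"
    by (simp add: card_insert_if card_image inj_on_def)
  finally have "card ?SW + card ?Sv \<le> 6 * ?d + L"
    using SW L by linarith
  hence "real (card ?SW + card ?Sv) \<le> real (6 * ?d + L)"
    by (rule of_nat_mono)
  hence sparse: "real (card ?SW + card ?Sv) \<le> s"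
    using s by simp
  have R0: "0 < R" using R by simp
  have "\<bar>net p W v L x 0\<bar> \<le> F" for x
  proof -
    have "\<bar>max 0 (\<epsilon> - (\<Sum>j<?d. \<bar>x j - coords t j\<bar>))\<bar> \<le> 1"
      using \<epsilon> sum_nonneg[of "{..<?d}" "\<lambda>j. \<bar>x j - coords t j\<bar>", OF abs_ge_zero] by linarith
    hence "\<bar>max 0 (\<epsilon> - (\<Sum>j<?d. \<bar>x j - coords t j\<bar>))\<bar> / \<bar>R\<bar> \<le> 1"
      using R(1) by (simp add: divide_le_eq)
    thus ?thesis using F unfolding net abs_divide by linarith
  qed
  moreover have "\<bar>W l i j\<bar> \<le> 1" for l i j
    using R by (simp add: W_def bump_weight_def)
  moreover have "\<bar>v l i\<bar> \<le> 1" for l i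
    using R(1) R0 \<epsilon> t[of i] t[of "i - ?d"] by (simp add: v_def bump_bias_def divide_le_eq)
  ultimately have "net p W v L \<in> relu_networks L p s F"
    using sparse p(2) unfolding relu_networks_def by (intro CollectI exI[of _ W] exI[of _ v]) auto
  moreover have "bump \<epsilon> (x - t) / R = net p W v L (coords x) 0" for x
  proof -
    have "(\<Sum>j<?d. \<bar>coords x j - coords t j\<bar>) = (\<Sum>i\<in>UNIV. \<bar>(x - t) $ i\<bar>)"
      using sum_coords[of abs "x - t"] by (simp add: coords_def)
    thus ?thesis by (simp add: net bump_def)
  qed
  ultimately show ?thesis
    unfolding critic_class_def by (intro CollectI exI[of _ "net p W v L"]) (simp add: fun_eq_iff)
qed

section \<open>Random functions independent of their argument\<close>

text \<open>By independence \<open>Z\<close> may be replaced by an independent copy. The inner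
  integral freezes the random function and averages over \<open>Z\<close> alone, which is how the
  critic functional sees a generator.\<close>

lemma
  fixes Z :: "'o \<Rightarrow> 'z::topological_space" and G :: "'o \<Rightarrow> 'z \<Rightarrow> 'b::topological_space"
  assumes M: "prob_space M" and Z [measurable]: "Z \<in> borel_measurable M"
    and G: "indep_random_function M Z G"
  shows measurable_indep_random_function: "(\<lambda>\<omega>. G \<omega> (Z \<omega>)) \<in> borel_measurable M"
    and measurable_indep_random_function_section:
      "\<And>\<omega>. \<omega> \<in> space M \<Longrightarrow> G \<omega> \<in> borel_measurable borel"
    and measurable_indep_random_function_integral:
      "\<And>f :: 'b \<Rightarrow> ennreal. f \<in> borel_measurable borel \<Longrightarrow>
         (\<lambda>\<omega>. \<integral>\<^sup>+\<omega>'. f (G \<omega> (Z \<omega>')) \<partial>M) \<in> borel_measurable M"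
    and nn_integral_indep_random_function:
      "\<And>f :: 'b \<Rightarrow> ennreal. f \<in> borel_measurable borel \<Longrightarrow>
         (\<integral>\<^sup>+\<omega>. \<integral>\<^sup>+\<omega>'. f (G \<omega> (Z \<omega>')) \<partial>M \<partial>M) = (\<integral>\<^sup>+\<omega>. f (G \<omega> (Z \<omega>)) \<partial>M)"
proof -
  interpret prob_space M by fact
  obtain A where A: "subalgebra M A" and GA [measurable]: "(\<lambda>(\<omega>, z). G \<omega> z) \<in> borel_measurable (A \<Otimes>\<^sub>M borel)"
    and ind: "indep_set (sets A) {Z -` B \<inter> space M |B. B \<in> sets borel}"
    using G unfolding indep_random_function_def by blast
  have sp: "space A = space M" and sub: "sets A \<subseteq> sets M"
    using A by (auto simp: subalgebra_def)
  have id [measurable]: "(\<lambda>\<omega>. \<omega>) \<in> measurable M A"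
    using sp sub by (auto intro!: measurableI dest: sets.sets_into_space)
  have "(\<lambda>\<omega>. (\<lambda>(\<omega>, z). G \<omega> z) (\<omega>, Z \<omega>)) \<in> borel_measurable M"
    by (rule measurable_compose[OF _ GA]) measurable
  thus meas [measurable]: "(\<lambda>\<omega>. G \<omega> (Z \<omega>)) \<in> borel_measurable M"
    by simp
  have "(\<lambda>z. (\<lambda>(\<omega>, z). G \<omega> z) (\<omega>, z)) \<in> borel_measurable borel" if "\<omega> \<in> space M" for \<omega>
    using that sp by (intro measurable_compose[OF _ GA]) auto
  thus "\<And>\<omega>. \<omega> \<in> space M \<Longrightarrow> G \<omega> \<in> borel_measurable borel"
    by (simp add: eta_contract_eq)
  \<comment> \<open>The image of \<open>M\<close> under the identity into \<open>A\<close> is the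
    restriction of \<open>M\<close> to \<open>A\<close>, the sigma-algebra for which
    \<open>G\<close> is jointly measurable.\<close>
  interpret MA: prob_space "distr M A (\<lambda>\<omega>. \<omega>)" by (rule prob_space_distr) fact
  interpret MZ: prob_space "distr M borel Z" by (rule prob_space_distr) fact
  \<comment> \<open>Independence gives the product formula on rectangles, which determine the joint
    law.\<close>
  have joint: "distr M A (\<lambda>\<omega>. \<omega>) \<Otimes>\<^sub>M distr M borel Z = distr M (A \<Otimes>\<^sub>M borel) (\<lambda>\<omega>. (\<omega>, Z \<omega>))"
  proof (rule pair_measure_eqI)
    fix a B assume "a \<in> sets (distr M A (\<lambda>\<omega>. \<omega>))" "B \<in> sets (distr M borel Z)"
    hence a [measurable]: "a \<in> sets A" and B [measurable]: "B \<in> sets borel" by simp_all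
    have "a \<subseteq> space M" using sets.sets_into_space[OF a] sp by simp
    hence eq: "a \<inter> space M = a" "(\<lambda>\<omega>. (\<omega>, Z \<omega>)) -` (a \<times> B) \<inter> space M = a \<inter> (Z -` B \<inter> space M)"
      by auto
    have "prob (a \<inter> (Z -` B \<inter> space M)) = prob a * prob (Z -` B \<inter> space M)"
      using B by (intro indep_setD[OF ind a]) auto
    thus "emeasure (distr M A (\<lambda>\<omega>. \<omega>)) a * emeasure (distr M borel Z) B
        = emeasure (distr M (A \<Otimes>\<^sub>M borel) (\<lambda>\<omega>. (\<omega>, Z \<omega>))) (a \<times> B)"
      by (simp add: emeasure_distr eq emeasure_eq_measure ennreal_mult)
  qed (auto intro: MA.sigma_finite_measure_axioms MZ.sigma_finite_measure_axioms sets_pair_measure_cong)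
  fix f :: "'b \<Rightarrow> ennreal" assume [measurable]: "f \<in> borel_measurable borel"
  have fG [measurable]: "(\<lambda>(\<omega>, z). f (G \<omega> z)) \<in> borel_measurable (A \<Otimes>\<^sub>M borel)"
    using measurable_compose[OF GA, of f borel] by (simp add: case_prod_beta)
  have *: "(\<lambda>\<omega>. \<integral>\<^sup>+z. f (G \<omega> z) \<partial>distr M borel Z) \<in> borel_measurable A"
    using MZ.borel_measurable_nn_integral[of "\<lambda>\<omega> z. f (G \<omega> z)" A] by simp
  have inner: "(\<integral>\<^sup>+z. f (G \<omega> z) \<partial>distr M borel Z) = (\<integral>\<^sup>+\<omega>'. f (G \<omega> (Z \<omega>')) \<partial>M)" if "\<omega> \<in> space M" for \<omega>
    using measurable_Pair2[OF fG, of \<omega>] that sp by (subst nn_integral_distr) auto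
  show "(\<lambda>\<omega>. \<integral>\<^sup>+\<omega>'. f (G \<omega> (Z \<omega>')) \<partial>M) \<in> borel_measurable M"
    by (rule measurable_cong[THEN iffD1, OF inner measurable_compose[OF id *]])
  have "(\<integral>\<^sup>+\<omega>. f (G \<omega> (Z \<omega>)) \<partial>M) = (\<integral>\<^sup>+x. (\<lambda>(\<omega>, z). f (G \<omega> z)) x \<partial>distr M (A \<Otimes>\<^sub>M borel) (\<lambda>\<omega>. (\<omega>, Z \<omega>)))"
    by (subst nn_integral_distr) auto
  also have "\<dots> = (\<integral>\<^sup>+\<omega>. \<integral>\<^sup>+z. f (G \<omega> z) \<partial>distr M borel Z \<partial>distr M A (\<lambda>\<omega>. \<omega>))"
    using MZ.nn_integral_fst[of "\<lambda>(\<omega>, z). f (G \<omega> z)" "distr M A (\<lambda>\<omega>. \<omega>)"] fG by (simp add: joint)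
  also have "\<dots> = (\<integral>\<^sup>+\<omega>. \<integral>\<^sup>+z. f (G \<omega> z) \<partial>distr M borel Z \<partial>M)"
    by (subst nn_integral_distr) auto
  also have "\<dots> = (\<integral>\<^sup>+\<omega>. \<integral>\<^sup>+\<omega>'. f (G \<omega> (Z \<omega>')) \<partial>M \<partial>M)"
    by (intro nn_integral_cong inner)
  finally show "(\<integral>\<^sup>+\<omega>. \<integral>\<^sup>+\<omega>'. f (G \<omega> (Z \<omega>')) \<partial>M \<partial>M) = (\<integral>\<^sup>+\<omega>. f (G \<omega> (Z \<omega>)) \<partial>M)" by simp
qed

section \<open>Testing the critic functional with a single critic\<close>

text \<open>Boundedness makes \<open>f\<close> integrable, so it competes in the supremum.
  \<open>e2ennreal\<close> sends negative values to 0, and the additive form of the inequality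
  remains valid under this truncation.\<close>

lemma nn_integral_le_critic_wasserstein:
  fixes X :: "'o \<Rightarrow> real^'d::finite" and Z :: "'o \<Rightarrow> real^'z::finite"
  assumes M: "prob_space M" and X [measurable]: "X \<in> borel_measurable M" and Z [measurable]: "Z \<in> borel_measurable M"
    and g [measurable]: "g \<in> borel_measurable borel"
    and f: "f \<in> C" "1-lipschitz_on UNIV f" "\<And>x. 0 \<le> f x" "\<And>x. f x \<le> B"
  shows "(\<integral>\<^sup>+\<omega>. ennreal (f (X \<omega>)) \<partial>M) \<le> e2ennreal (critic_wasserstein M X Z C g) + (\<integral>\<^sup>+\<omega>. ennreal (f (g (Z \<omega>))) \<partial>M)"
proof -
  interpret prob_space M by fact
  have [measurable]: "f \<in> borel_measurable borel"
    using lipschitz_on_continuous_on[OF f(2)] by (rule borel_measurable_continuous_onI)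
  have int: "integrable M (\<lambda>\<omega>. f (V \<omega>))" if [measurable]: "V \<in> borel_measurable M" for V
    using f(3,4) by (intro integrable_const_bound[of _ B]) auto
  let ?a = "\<integral>\<omega>. f (X \<omega>) \<partial>M" and ?b = "\<integral>\<omega>. f (g (Z \<omega>)) \<partial>M"
  have "ereal (?a - ?b) \<le> critic_wasserstein M X Z C g"
    unfolding critic_wasserstein_def using f(1,2) int[of "\<lambda>\<omega>. g (Z \<omega>)"] by (intro SUP_upper) auto
  hence "ennreal (?a - ?b) \<le> e2ennreal (critic_wasserstein M X Z C g)"
    using e2ennreal_mono[of "ereal (?a - ?b)"] by simp
  moreover have "ennreal ?a \<le> ennreal (?a - ?b) + ennreal ?b"
    using f(3) by (cases "?b \<le> ?a") (auto simp flip: ennreal_plus simp: ennreal_neg intro!: ennreal_leI)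
  ultimately show ?thesis
    using f(3) by (simp add: nn_integral_eq_integral int) (meson add_right_mono order_trans)
qed

text \<open>The critic functional is not known to be measurable in \<open>\<omega>\<close>, so
  additivity of the integral is applied to the measurable function \<open>?a - h \<omega>\<close>,
  and \<open>?w\<close> enters by monotonicity only.\<close>

lemma nn_integral_le_expected_critic_wasserstein:
  fixes X :: "'o \<Rightarrow> real^'d::finite" and Z :: "'o \<Rightarrow> real^'z::finite"
  assumes M: "prob_space M" and X: "X \<in> borel_measurable M" and Z: "Z \<in> borel_measurable M"
    and G: "indep_random_function M Z G"
    and f: "f \<in> C" "1-lipschitz_on UNIV f" "\<And>x. 0 \<le> f x" "\<And>x. f x \<le> B"
  shows "(\<integral>\<^sup>+\<omega>. ennreal (f (X \<omega>)) \<partial>M)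
    \<le> (\<integral>\<^sup>+\<omega>. e2ennreal (critic_wasserstein M X Z C (G \<omega>)) \<partial>M) + (\<integral>\<^sup>+\<omega>. ennreal (f (G \<omega> (Z \<omega>))) \<partial>M)"
    (is "?a \<le> ?w + _")
proof -
  interpret prob_space M by fact
  have [measurable]: "f \<in> borel_measurable borel"
    using lipschitz_on_continuous_on[OF f(2)] by (rule borel_measurable_continuous_onI)
  define h where "h \<omega> = (\<integral>\<^sup>+\<omega>'. ennreal (f (G \<omega> (Z \<omega>'))) \<partial>M)" for \<omega>
  have [measurable]: "h \<in> borel_measurable M"
    unfolding h_def by (rule measurable_indep_random_function_integral[OF M Z G]) simp
  have "?a \<le> (\<integral>\<^sup>+\<omega>. ennreal B \<partial>M)"
    using f(4) by (intro nn_integral_mono ennreal_leI)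
  hence fin: "?a \<noteq> top"
    by (auto simp: emeasure_space_1 top_unique)
  have "?a = (\<integral>\<^sup>+\<omega>. ?a \<partial>M)"
    by (simp add: emeasure_space_1)
  \<comment> \<open>Subtraction on \<open>ennreal\<close> truncates at 0, so the inequality also
    holds where \<open>h \<omega>\<close> exceeds \<open>?a\<close>.\<close>
  also have "\<dots> \<le> (\<integral>\<^sup>+\<omega>. (?a - h \<omega>) + h \<omega> \<partial>M)"
    by (intro nn_integral_mono) (metis add.commute ennreal_minus_le_iff fin order_refl)
  also have "\<dots> = (\<integral>\<^sup>+\<omega>. ?a - h \<omega> \<partial>M) + (\<integral>\<^sup>+\<omega>. h \<omega> \<partial>M)"
    by (intro nn_integral_add) measurable
  also have "(\<integral>\<^sup>+\<omega>. ?a - h \<omega> \<partial>M) \<le> ?w"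
  proof (intro nn_integral_mono)
    fix \<omega> assume "\<omega> \<in> space M"
    from nn_integral_le_critic_wasserstein[OF M X Z measurable_indep_random_function_section[OF M Z G this] f]
    show "?a - h \<omega> \<le> e2ennreal (critic_wasserstein M X Z C (G \<omega>))"
      using fin by (simp add: ennreal_minus_le_iff h_def add.commute)
  qed
  also have "(\<integral>\<^sup>+\<omega>. h \<omega> \<partial>M) = (\<integral>\<^sup>+\<omega>. ennreal (f (G \<omega> (Z \<omega>))) \<partial>M)"
    unfolding h_def by (rule nn_integral_indep_random_function[OF M Z G]) simp
  finally show ?thesis by (simp add: add_right_mono)
qed

section \<open>From one-sided bounds to convergence in distribution\<close>

lemma converges_in_distribution_if_bumps:
  fixes X :: "'o \<Rightarrow> real^'d::finite"
  assumes M: "prob_space M"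
    and X [measurable]: "X \<in> borel_measurable M"
    and Y [measurable]: "\<And>n. Y n \<in> borel_measurable M"
    and bX: "\<And>\<omega>. \<omega> \<in> space M \<Longrightarrow> norm (X \<omega>) \<le> r"
    and bump: "\<And>t \<epsilon>. 0 < \<epsilon> \<Longrightarrow> \<epsilon> \<le> 1 \<Longrightarrow>
       (\<integral>\<^sup>+\<omega>. ennreal (bump \<epsilon> (X \<omega> - t)) \<partial>M) \<le> liminf (\<lambda>n. \<integral>\<^sup>+\<omega>. ennreal (bump \<epsilon> (Y n \<omega> - t)) \<partial>M)"
  shows "converges_in_distribution M Y X"
  unfolding converges_in_distribution_def
proof (intro allI impI, elim conjE)
  interpret prob_space M by fact
  fix \<phi> :: "real^'d \<Rightarrow> real"
  assume cont: "continuous_on UNIV \<phi>" and "bounded (range \<phi>)"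
  then obtain B where B: "\<And>x. \<bar>\<phi> x\<bar> \<le> B"
    by (auto simp: bounded_iff)
  \<comment> \<open>Stated for a general \<open>\<psi>\<close>, since it is applied to both
    \<open>\<phi>\<close> and its negative.\<close>
  have lower: "\<forall>\<^sub>F n in sequentially. a < (\<integral>\<omega>. \<psi> (Y n \<omega>) \<partial>M)"
    if cont: "continuous_on UNIV \<psi>" and B: "\<And>x. \<bar>\<psi> x\<bar> \<le> B" and a: "a < (\<integral>\<omega>. \<psi> (X \<omega>) \<partial>M)" for \<psi> a
  proof -
    have [measurable]: "\<psi> \<in> borel_measurable borel"
      using cont by (rule borel_measurable_continuous_onI)
    have int: "integrable M (\<lambda>\<omega>. \<psi> (V \<omega>))" if [measurable]: "V \<in> borel_measurable M" for V
      using B by (intro integrable_const_bound[of _ B]) auto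
    have nn: "0 \<le> B + \<psi> x" for x using B[of x] by linarith
    have eq: "(\<integral>\<^sup>+\<omega>. ennreal (B + \<psi> (V \<omega>)) \<partial>M) = ennreal (B + (\<integral>\<omega>. \<psi> (V \<omega>) \<partial>M))"
      if [measurable]: "V \<in> borel_measurable M" for V
      using nn int[of V] by (subst nn_integral_eq_integral) (auto simp: prob_space)
    have nnI: "0 \<le> B + (\<integral>\<omega>. \<psi> (V \<omega>) \<partial>M)" if [measurable]: "V \<in> borel_measurable M" for V
    proof -
      have "0 \<le> (\<integral>\<omega>. B + \<psi> (V \<omega>) \<partial>M)" by (intro Bochner_Integration.integral_nonneg nn)
      thus ?thesis using int[of V] by (simp add: prob_space)
    qed
    show ?thesis
    \<comment> \<open>\<open>ennreal\<close> collapses negative numbers to 0, so comparison there is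
      faithful only for \<open>0 \<le> B + a\<close>. Otherwise the claim is immediate, as
      \<open>B\<close> plus each integral is nonnegative.\<close>
    proof (cases "0 \<le> B + a")
      case True
      have "ennreal (B + (\<integral>\<omega>. \<psi> (X \<omega>) \<partial>M)) \<le> liminf (\<lambda>n. ennreal (B + (\<integral>\<omega>. \<psi> (Y n \<omega>) \<partial>M)))"
        using nn_integral_le_liminf_of_bumps[OF M X Y bX bump, where \<phi>="\<lambda>x. B + \<psi> x"] cont nn
        by (simp add: eq continuous_on_add)
      moreover have "ennreal (B + a) < ennreal (B + (\<integral>\<omega>. \<psi> (X \<omega>) \<partial>M))"
        using a True by (intro ennreal_lessI) auto
      ultimately have "\<forall>\<^sub>F n in sequentially. ennreal (B + a) < ennreal (B + (\<integral>\<omega>. \<psi> (Y n \<omega>) \<partial>M))"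
        unfolding le_Liminf_iff by blast
      thus ?thesis
        by eventually_elim (use True in \<open>simp add: ennreal_less_iff\<close>)
    next
      case False
      thus ?thesis using nnI[OF Y] by (intro always_eventually allI) (smt (verit))
    qed
  qed
  show "(\<lambda>n. \<integral>\<omega>. \<phi> (Y n \<omega>) \<partial>M) \<longlonglongrightarrow> (\<integral>\<omega>. \<phi> (X \<omega>) \<partial>M)"
  proof (rule order_tendstoI)
    fix a assume "a < (\<integral>\<omega>. \<phi> (X \<omega>) \<partial>M)"
    thus "\<forall>\<^sub>F n in sequentially. a < (\<integral>\<omega>. \<phi> (Y n \<omega>) \<partial>M)"
      by (rule lower[OF cont B])
  next
    fix a assume "(\<integral>\<omega>. \<phi> (X \<omega>) \<partial>M) < a"
    thus "\<forall>\<^sub>F n in sequentially. (\<integral>\<omega>. \<phi> (Y n \<omega>) \<partial>M) < a"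
      using lower[of "\<lambda>x. - \<phi> x" "- a"] cont B by (simp add: continuous_on_minus)
  qed
qed

section \<open>Growing critic classes and the limit of the generated laws\<close>

text \<open>The product is \<open>n\<close> to the power d / (2 \<open>\<gamma>\<close> + d), a
  positive exponent. Hence the widths eventually exceed any fixed number.\<close>

lemma filterlim_mult_rate:
  assumes "0 \<le> \<gamma>" "0 < d"
  shows "filterlim (\<lambda>n. real n * rate \<gamma> d n) at_top sequentially"
proof -
  define e where "e = 1 - 2 * \<gamma> / (2 * \<gamma> + real d)"
  have e: "0 < e" using assms by (simp add: e_def field_simps)
  have "filterlim (\<lambda>n. exp (e * ln (real n))) at_top sequentially"
    by (intro filterlim_compose[OF exp_at_top] filterlim_tendsto_pos_mult_at_top[OF tendsto_const e]
        filterlim_compose[OF ln_at_top] filterlim_real_sequentially)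
  moreover have "\<forall>\<^sub>F n in sequentially. exp (e * ln (real n)) = real n * rate \<gamma> d n"
    using eventually_gt_at_top[of 0]
  proof eventually_elim
    case (elim n)
    hence "exp (e * ln (real n)) = real n powr (1 + - (2 * \<gamma> / (2 * \<gamma> + real d)))"
      by (simp add: powr_def e_def)
    thus ?case using elim unfolding powr_add rate_def by simp
  qed
  ultimately show ?thesis
    by (rule filterlim_cong[OF refl refl, THEN iffD1, rotated])
qed

text \<open>The divergence of \<open>s\<^sub>f n - real (L\<^sub>f n)\<close> keeps the critics from
  being too sparse for their depth. If \<open>s\<^sub>f n\<close> were at most
  \<open>L\<^sub>f n\<close>, one of the \<open>L\<^sub>f n + 1\<close> weight matrices would
  vanish; every critic would be constant and the functional would carry no information.\<close>

theorem lemma3p2: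
  fixes M :: "'o measure"
    and X :: "'o \<Rightarrow> real^'d::finite"
    and Z :: "'o \<Rightarrow> real^'z::finite"
    and gstar :: "real^'z \<Rightarrow> real^'d"
    and ghat :: "nat \<Rightarrow> 'o \<Rightarrow> real^'z \<Rightarrow> real^'d"
    and dg :: nat
    and \<beta> K \<gamma> c\<^sub>1 c\<^sub>2 :: real
    and L\<^sub>f :: "nat \<Rightarrow> nat"
    and p\<^sub>f :: "nat \<Rightarrow> nat \<Rightarrow> nat"
    and s\<^sub>f F :: "nat \<Rightarrow> real"
  assumes "prob_space M"
    and "X \<in> borel_measurable M" and "\<forall>\<omega>\<in>space M. X \<omega> \<in> cbox 0 1"
    and "Z \<in> borel_measurable M" and "\<forall>\<omega>\<in>space M. Z \<omega> \<in> cbox 0 1"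
    and "\<beta> \<ge> 1" and "K > 0"
    and "gstar \<in> generator_class dg \<beta> K"
    and "distr M borel X = distr M borel (\<lambda>\<omega>. gstar (Z \<omega>))"
    and "\<gamma> \<ge> 1" and "c\<^sub>1 > 0" and "c\<^sub>2 > 0"
    and "\<forall>n\<ge>1. p\<^sub>f n 0 = CARD('d) \<and> p\<^sub>f n (L\<^sub>f n + 1) = 1"
    and "\<forall>n\<ge>1. s\<^sub>f n > 0"
    and "\<forall>n\<ge>1. F n \<ge> 1"
    and "\<forall>n\<ge>1. real (L\<^sub>f n) \<ge>
           log 2 (real n) * log 2 (max (4 * real CARD('d)) (4 * \<gamma>))"
    and "\<forall>n\<ge>1. \<forall>i\<in>{1..L\<^sub>f n}.
           real (p\<^sub>f n i) \<ge> c\<^sub>1 * (real n * rate \<gamma> CARD('d) n)"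
    and "\<forall>n\<ge>1. s\<^sub>f n \<ge> c\<^sub>2 * (ln (real n) * (real n * rate \<gamma> CARD('d) n))"
    and "filterlim (\<lambda>n. s\<^sub>f n - real (L\<^sub>f n)) at_top sequentially"
    and "\<forall>n\<ge>1. indep_random_function M Z (ghat n)"
    and "(\<lambda>n. \<integral>\<^sup>+\<omega>. e2ennreal
             (critic_wasserstein M X Z (critic_class (L\<^sub>f n) (p\<^sub>f n) (s\<^sub>f n) (F n)) (ghat n \<omega>)) \<partial>M)
           \<longlonglongrightarrow> 0"
  shows "converges_in_distribution M (\<lambda>n \<omega>. ghat n \<omega> (Z \<omega>)) (\<lambda>\<omega>. gstar (Z \<omega>)) \<and>
         distr M borel (\<lambda>\<omega>. gstar (Z \<omega>)) = distr M borel X"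
proof
  note M = assms(1) and X [measurable] = assms(2) and Z [measurable] = assms(4)
  interpret prob_space M by fact
  have [measurable]: "gstar \<in> borel_measurable borel"
    using assms(8) by (simp add: generator_class_def)
  show "distr M borel (\<lambda>\<omega>. gstar (Z \<omega>)) = distr M borel X"
    using assms(9) by simp
  define Y where "Y n \<omega> = ghat n \<omega> (Z \<omega>)" for n \<omega>
  have Y [measurable]: "Y n \<in> borel_measurable M" if "1 \<le> n" for n
    unfolding Y_def using assms(20) that by (intro measurable_indep_random_function[OF M Z]) auto
  have bX: "norm (X \<omega>) \<le> real CARD('d)" if "\<omega> \<in> space M" for \<omega>
  proof -
    have "\<bar>X \<omega> $ i\<bar> \<le> 1" for i
      using assms(3) that by (auto simp: mem_box_cart)
    hence "(\<Sum>i\<in>UNIV. \<bar>X \<omega> $ i\<bar>) \<le> (\<Sum>i\<in>(UNIV :: 'd set). 1)"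
      by (intro sum_mono)
    thus ?thesis using norm_le_l1_cart[of "X \<omega>"] by simp
  qed
  define w where "w n = (\<integral>\<^sup>+\<omega>. e2ennreal
    (critic_wasserstein M X Z (critic_class (L\<^sub>f n) (p\<^sub>f n) (s\<^sub>f n) (F n)) (ghat n \<omega>)) \<partial>M)" for n
  \<comment> \<open>The assumptions on \<open>ghat n\<close> start at \<open>n = 1\<close>, whereas
    the lemmas on sequences ask for measurability of every member; hence the shift by
    \<open>Suc\<close>.\<close>
  have liminf_ge: "(\<integral>\<^sup>+\<omega>. ennreal (bump \<epsilon> (X \<omega> - t)) \<partial>M) \<le> liminf (\<lambda>n. \<integral>\<^sup>+\<omega>. ennreal (bump \<epsilon> (Y (Suc n) \<omega> - t)) \<partial>M)"
    if \<epsilon>: "0 < \<epsilon>" "\<epsilon> \<le> 1" for t :: "real^'d" and \<epsilon>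
  proof -
    \<comment> \<open>\<open>R\<close> dominates 1 and all coordinates of \<open>t\<close>, so that
      the network entries are admissible, and the Lipschitz constant of the bump. It does not depend
      on \<open>n\<close>, so \<open>ennreal R * w n\<close> still tends to 0.\<close>
    define R where "R = 1 + real CARD('d) + norm t"
    have R: "1 \<le> R" "0 < R" "real CARD('d) \<le> R"
      by (simp_all add: R_def add_pos_nonneg)
    have t: "\<bar>t $ i\<bar> \<le> R" for i
      using component_le_norm_cart[of t i] by (simp add: R_def)
    define f where "f x = bump \<epsilon> (x - t) / R" for x :: "real^'d"
    have [measurable]: "f \<in> borel_measurable borel" unfolding f_def by measurable
    have f: "1-lipschitz_on UNIV f" "\<And>x. 0 \<le> f x" "\<And>x. f x \<le> \<epsilon> / R"
    proof -
      show "0 \<le> f x" "f x \<le> \<epsilon> / R" for x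
        using R(2) bump_le[OF \<epsilon>(1), of "x - t"] by (simp_all add: f_def bump_nonneg divide_right_mono)
      have "\<bar>f x - f y\<bar> \<le> norm (x - y)" for x y
      proof -
        have "\<bar>bump \<epsilon> (x - t) - bump \<epsilon> (y - t)\<bar> \<le> real CARD('d) * norm (x - y)"
          using bump_lipschitz[of \<epsilon> "x - t" "y - t"] by simp
        also have "\<dots> \<le> R * norm (x - y)"
          using R by (intro mult_right_mono) auto
        finally show ?thesis
          using R by (simp add: f_def diff_divide_distrib[symmetric] abs_divide divide_le_eq mult.commute)
      qed
      thus "1-lipschitz_on UNIV f" by (intro lipschitz_onI) (auto simp: dist_norm)
    qed
    have scale: "(\<integral>\<^sup>+\<omega>. ennreal (bump \<epsilon> (V \<omega> - t)) \<partial>M) = ennreal R * (\<integral>\<^sup>+\<omega>. ennreal (f (V \<omega>)) \<partial>M)"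
      if [measurable]: "V \<in> borel_measurable M" for V
      using R f(2) by (simp add: nn_integral_cmult[symmetric] ennreal_mult'[symmetric]) (simp add: f_def)
    let ?a = "\<integral>\<^sup>+\<omega>. ennreal (bump \<epsilon> (X \<omega> - t)) \<partial>M"
    let ?b = "\<lambda>n. \<integral>\<^sup>+\<omega>. ennreal (bump \<epsilon> (Y n \<omega> - t)) \<partial>M"
    have "?a \<le> (\<integral>\<^sup>+\<omega>. ennreal \<epsilon> \<partial>M)"
      using bump_le[OF \<epsilon>(1)] by (intro nn_integral_mono ennreal_leI)
    hence fin: "?a \<noteq> top" by (auto simp: emeasure_space_1 top_unique)
    \<comment> \<open>Eventually every hidden layer has room for the 2d neurons, and the sparsity
      budget for the 6d parameters beyond one per layer.\<close>
    have "\<forall>\<^sub>F n in sequentially. 2 * real CARD('d) / c\<^sub>1 \<le> real n * rate \<gamma> CARD('d) n"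
      using filterlim_mult_rate[of \<gamma> "CARD('d)"] assms(10) unfolding filterlim_at_top by auto
    moreover have "\<forall>\<^sub>F n in sequentially. 6 * real CARD('d) \<le> s\<^sub>f n - real (L\<^sub>f n)"
      using assms(19) unfolding filterlim_at_top by auto
    ultimately have "\<forall>\<^sub>F n in sequentially. ?a - ennreal R * w n \<le> ?b n"
      using eventually_ge_at_top[of 2]
    proof eventually_elim
      case (elim n)
      hence n: "1 \<le> n" by simp
      \<comment> \<open>From \<open>n = 2\<close> on the first logarithm is at least 1; the second
        is at least 2 because 4 \<open>\<gamma>\<close> is at least 4. This secures two hidden
        layers.\<close>
      have "1 * 2 \<le> log 2 (real n) * log 2 (max (4 * real CARD('d)) (4 * \<gamma>))"
      proof (intro mult_mono)
        show "1 \<le> log 2 (real n)" using elim by (simp add: le_log_iff)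
        have "2 powr 2 \<le> max (4 * real CARD('d)) (4 * \<gamma>)" using assms(10) by simp
        thus "2 \<le> log 2 (max (4 * real CARD('d)) (4 * \<gamma>))" using assms(10) by (subst le_log_iff) auto
      qed (use elim in auto)
      hence L: "2 \<le> L\<^sub>f n" using assms(16) n by (metis (no_types) mult_1 of_nat_le_iff of_nat_numeral order_trans)
      have p: "2 * CARD('d) \<le> p\<^sub>f n i" if "i \<in> {1..L\<^sub>f n}" for i
      proof -
        have "2 * real CARD('d) \<le> c\<^sub>1 * (real n * rate \<gamma> CARD('d) n)"
          using elim assms(11) by (simp add: divide_le_eq mult.commute)
        also have "\<dots> \<le> real (p\<^sub>f n i)" using assms(17) n that by blast
        finally show ?thesis by linarith
      qed
      have "f \<in> critic_class (L\<^sub>f n) (p\<^sub>f n) (s\<^sub>f n) (F n)"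
        using assms(13,15) n elim unfolding f_def
        by (intro bump_in_critic_class \<epsilon> R t L p) auto
      hence "(\<integral>\<^sup>+\<omega>. ennreal (f (X \<omega>)) \<partial>M) \<le> w n + (\<integral>\<^sup>+\<omega>. ennreal (f (Y n \<omega>)) \<partial>M)"
        unfolding w_def Y_def using assms(20) n
        by (intro nn_integral_le_expected_critic_wasserstein[OF M X Z _ _ f]) auto
      hence "?a \<le> ennreal R * w n + ?b n"
        unfolding scale[OF X] scale[OF Y[OF n]] by (metis distrib_left mult_left_mono zero_le)
      thus ?case using fin by (simp add: ennreal_minus_le_iff)
    qed
    hence ev: "\<forall>\<^sub>F n in sequentially. ?a - ennreal R * w (Suc n) \<le> ?b (Suc n)"
      by (subst eventually_sequentially_Suc)
    have "(\<lambda>n. ennreal R * w (Suc n)) \<longlonglongrightarrow> ennreal R * 0"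
      using assms(21) unfolding w_def[symmetric]
      by (intro ennreal_tendsto_cmult LIMSEQ_Suc) auto
    hence "(\<lambda>n. ?a - ennreal R * w (Suc n)) \<longlonglongrightarrow> ?a - 0"
      using fin by (intro tendsto_diff_ennreal tendsto_const) auto
    hence "?a = liminf (\<lambda>n. ?a - ennreal R * w (Suc n))"
      by (simp add: lim_imp_Liminf)
    also have "\<dots> \<le> liminf (\<lambda>n. ?b (Suc n))"
      by (rule Liminf_mono[OF ev])
    finally show ?thesis .
  qed
  have conv: "converges_in_distribution M (\<lambda>n. Y (Suc n)) X"
    using bX liminf_ge by (intro converges_in_distribution_if_bumps[OF M X]) auto
  show "converges_in_distribution M (\<lambda>n \<omega>. ghat n \<omega> (Z \<omega>)) (\<lambda>\<omega>. gstar (Z \<omega>))"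
    unfolding converges_in_distribution_def
  proof (intro allI impI, elim conjE)
    fix \<phi> :: "real^'d \<Rightarrow> real"
    assume cont: "continuous_on UNIV \<phi>" and bdd: "bounded (range \<phi>)"
    have [measurable]: "\<phi> \<in> borel_measurable borel"
      using cont by (rule borel_measurable_continuous_onI)
    \<comment> \<open>Test integrals depend on the law only, so \<open>X\<close> may be exchanged
      for \<open>gstar (Z \<omega>)\<close> in the limit.\<close>
    have "(\<integral>\<omega>. \<phi> (X \<omega>) \<partial>M) = (\<integral>x. \<phi> x \<partial>distr M borel X)"
      by (simp add: integral_distr)
    also have "\<dots> = (\<integral>\<omega>. \<phi> (gstar (Z \<omega>)) \<partial>M)"
      unfolding assms(9) by (simp add: integral_distr)
    finally have "(\<lambda>n. \<integral>\<omega>. \<phi> (Y (Suc n) \<omega>) \<partial>M) \<longlonglongrightarrow> (\<integral>\<omega>. \<phi> (gstar (Z \<omega>)) \<partial>M)"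
      using conv cont bdd by (auto simp: converges_in_distribution_def)
    thus "(\<lambda>n. \<integral>\<omega>. \<phi> (ghat n \<omega> (Z \<omega>)) \<partial>M) \<longlonglongrightarrow> (\<integral>\<omega>. \<phi> (gstar (Z \<omega>)) \<partial>M)"
      unfolding Y_def by (rule LIMSEQ_imp_Suc)
  qed
qed

end
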